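(* Let $X$ be a finite ground set, let $d\ge 0$ be an integer, and let $f:2^X\to\mathbb{R}$ be a normalized monotone set function. Then $f$ is $d$-scopic submodular if and only if $\mathrm{SMW}(f)\le d$.
   Context: A set function $f:2^X\to\mathbb{R}$ is normalized if $f(\emptyset)=0$ and monotone if $f(S)\le f(T)$ whenever $S\subseteq T\subseteq X$. For $S,T\subseteq X$ write $f(S\mid T)=f(S\cup T)-f(T)$, and $f(v\mid T)=f(\{v\}\mid T)$ for $v\in X$. A set $T\subseteq X$ is supermodular w.r.t. $f$ if there exist $S\subseteq X$ and $v\in X\setminus T$ such that $f(v\mid S\cup T)>\max_{T'\subsetneq T} f(v\mid S\cup T')$. The supermodular width $\mathrm{SMW}(f)$ is the maximum cardinality of a nonempty supermodular set w.r.t. $f$ (and $0$ if there is none). For an integer $d\ge 0$, $f$ is $d$-scopic submodular if for all $S,T\subseteq X$ and $v\in X$ with $S\subseteq T$ and $v\notin T$: $f(v\mid T)\le \max_{T'\subseteq T,\ |T'|\le d} f(v\mid S\cup T')$. *)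

theory Defs
  imports Complex_Main
begin

definition normalized :: "('a set \<Rightarrow> real) \<Rightarrow> bool" where
  "normalized f \<longleftrightarrow> f {} = 0"

definition monotone_set_fun :: "'a set \<Rightarrow> ('a set \<Rightarrow> real) \<Rightarrow> bool" where
  "monotone_set_fun X f \<longleftrightarrow> (\<forall>S T. S \<subseteq> T \<and> T \<subseteq> X \<longrightarrow> f S \<le> f T)"

definition marginal :: "('a set \<Rightarrow> real) \<Rightarrow> 'a set \<Rightarrow> 'a set \<Rightarrow> real" where
  "marginal f S T = f (S \<union> T) - f T"

(* For T = {} the maximum ranges over the empty set and is unspecified; only nonempty T
   are ever considered, in the definition of SMW below. *)
definition supermodular_set :: "'a set \<Rightarrow> ('a set \<Rightarrow> real) \<Rightarrow> 'a set \<Rightarrow> bool" where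
  "supermodular_set X f T \<longleftrightarrow> T \<subseteq> X \<and>
     (\<exists>S v. S \<subseteq> X \<and> v \<in> X - T \<and>
        marginal f {v} (S \<union> T) > (MAX T'\<in>{T'. T' \<subset> T}. marginal f {v} (S \<union> T')))"

definition SMW :: "'a set \<Rightarrow> ('a set \<Rightarrow> real) \<Rightarrow> nat" where
  "SMW X f = (if \<exists>T. T \<noteq> {} \<and> supermodular_set X f T
              then Max {card T | T. T \<noteq> {} \<and> supermodular_set X f T}
              else 0)"

definition scopic_submodular :: "nat \<Rightarrow> 'a set \<Rightarrow> ('a set \<Rightarrow> real) \<Rightarrow> bool" where
  "scopic_submodular d X f \<longleftrightarrow>
     (\<forall>S T v. T \<subseteq> X \<and> S \<subseteq> T \<and> v \<in> X \<and> v \<notin> T \<longrightarrow>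
        marginal f {v} T \<le> (MAX T'\<in>{T'. T' \<subseteq> T \<and> card T' \<le> d}. marginal f {v} (S \<union> T')))"

end

theory Submission imports Defs begin

text \<open>
  If \<open>T\<close> is supermodular with witnesses \<open>S\<close> and \<open>v\<close>, scopic submodularity applied to
  \<open>S \<subseteq> S \<union> T\<close> gives a set \<open>T'\<close> of size at most \<open>d\<close>, and its trace on \<open>T\<close> can only be all of \<open>T\<close>.
  Conversely, among all \<open>T' \<subseteq> T\<close> with \<open>f(v | S \<union> T') \<ge> f(v | T)\<close> an inclusion-minimal one is either
  empty or supermodular, so it has size at most \<open>d\<close>.
\<close>

text \<open>For nonempty \<open>T\<close> the proper subsets include \<open>{}\<close>, so the
  maximum is over a finite nonempty family and unfolds to a pointwise condition. For
  \<open>T = {}\<close> it would be \<open>Max {}\<close>, which is unspecified.\<close>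

lemma supermodular_set_iff:
  assumes "finite X" and "T \<noteq> {}"
  shows "supermodular_set X f T \<longleftrightarrow> T \<subseteq> X \<and>
    (\<exists>S v. S \<subseteq> X \<and> v \<in> X - T \<and>
      (\<forall>T'. T' \<subset> T \<longrightarrow> marginal f {v} (S \<union> T') < marginal f {v} (S \<union> T)))"
proof (cases "T \<subseteq> X")
  case True
  have "finite T"
    using True assms(1) by (rule finite_subset)
  then have "finite {T'. T' \<subset> T}"
    by (simp add: psubset_eq)
  moreover have "{T'. T' \<subset> T} \<noteq> {}"
    using assms(2) by blast
  ultimately have "(MAX T'\<in>{T'. T' \<subset> T}. g T') < m \<longleftrightarrow> (\<forall>T'. T' \<subset> T \<longrightarrow> g T' < m)"
    for g and m :: real
    by simp
  then show ?thesis
    unfolding supermodular_set_def by simp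
qed (simp add: supermodular_set_def)

lemma scopic_submodular_iff:
  assumes "finite X"
  shows "scopic_submodular d X f \<longleftrightarrow>
    (\<forall>S T v. T \<subseteq> X \<and> S \<subseteq> T \<and> v \<in> X \<and> v \<notin> T \<longrightarrow>
      (\<exists>T'\<subseteq>T. card T' \<le> d \<and> marginal f {v} T \<le> marginal f {v} (S \<union> T')))"
proof -
  have le_Max_iff: "m \<le> (MAX T'\<in>{T'. T' \<subseteq> T \<and> card T' \<le> d}. g T') \<longleftrightarrow>
      (\<exists>T'\<subseteq>T. card T' \<le> d \<and> m \<le> g T')"
    if "T \<subseteq> X" for T and m :: real and g
  proof -
    have "finite T"
      using that assms by (rule finite_subset)
    then have "finite {T'. T' \<subseteq> T \<and> card T' \<le> d}"
      by simp
    \<comment> \<open>The empty set is admissible even for \<open>d = 0\<close>, so this maximum is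
      never over an empty family.\<close>
    moreover have "{} \<in> {T'. T' \<subseteq> T \<and> card T' \<le> d}"
      by simp
    ultimately show ?thesis
      by (subst Max_ge_iff) (blast, blast, blast)
  qed
  show ?thesis
    unfolding scopic_submodular_def by (intro iff_allI imp_cong refl le_Max_iff) (elim conjE)
qed

text \<open>Finiteness of \<open>X\<close> bounds the cardinalities, so \<open>Max\<close> is
  attained; the default value 0 matches the vacuous case on the right.\<close>

lemma SMW_le_iff:
  assumes "finite X"
  shows "SMW X f \<le> d \<longleftrightarrow> (\<forall>T. T \<noteq> {} \<and> supermodular_set X f T \<longrightarrow> card T \<le> d)"
proof -
  have "{card T | T. T \<noteq> {} \<and> supermodular_set X f T} \<subseteq> card ` Pow X"
    by (auto simp: supermodular_set_def)
  then have "finite {card T | T. T \<noteq> {} \<and> supermodular_set X f T}"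
    using assms by (meson finite_Pow_iff finite_imageI finite_subset)
  then show ?thesis
    unfolding SMW_def by auto
qed

lemma card_supermodular_set_le:
  assumes "finite X" and scopic: "scopic_submodular d X f"
    and "T \<noteq> {}" and "supermodular_set X f T"
  shows "card T \<le> d"
proof -
  obtain S v where "T \<subseteq> X" "S \<subseteq> X" "v \<in> X" "v \<notin> T"
    and less: "\<And>T'. T' \<subset> T \<Longrightarrow> marginal f {v} (S \<union> T') < marginal f {v} (S \<union> T)"
    using assms(4) unfolding supermodular_set_iff[OF assms(1,3)] by blast
  \<comment> \<open>The definition only keeps \<open>v\<close> out of \<open>T\<close>, while scopic
    submodularity needs \<open>v\<close> outside \<open>S \<union> T\<close>. If \<open>v\<close>
    were in \<open>S\<close>, both marginals would be 0, against strictness at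
    \<open>{}\<close>.\<close>
  have "v \<notin> S"
    using less[of "{}"] \<open>T \<noteq> {}\<close> by (auto simp: marginal_def insert_absorb psubset_eq)
  then obtain T' where T': "T' \<subseteq> S \<union> T" "card T' \<le> d"
    and le: "marginal f {v} (S \<union> T) \<le> marginal f {v} (S \<union> T')"
    using scopic[unfolded scopic_submodular_iff[OF assms(1)], rule_format, of "S \<union> T" S v]
      \<open>T \<subseteq> X\<close> \<open>S \<subseteq> X\<close> \<open>v \<in> X\<close> \<open>v \<notin> T\<close> by auto
  \<comment> \<open>\<open>T'\<close> may leave \<open>T\<close>, but only inside \<open>S\<close>,
    so cutting it down to \<open>T\<close> keeps the union and hence the marginal.\<close>
  have "S \<union> (T' \<inter> T) = S \<union> T'"
    using T'(1) by blast
  then have "\<not> T' \<inter> T \<subset> T"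
    using less[of "T' \<inter> T"] le by auto
  then have "T \<subseteq> T'"
    by blast
  moreover have "finite T'"
    using T'(1) \<open>T \<subseteq> X\<close> \<open>S \<subseteq> X\<close> assms(1) by (meson Un_least finite_subset)
  ultimately show ?thesis
    using T'(2) card_mono le_trans by blast
qed

lemma scopic_submodular_if_card_supermodular_set_le:
  assumes "finite X"
    and card_le: "\<And>T. T \<noteq> {} \<Longrightarrow> supermodular_set X f T \<Longrightarrow> card T \<le> d"
  shows "scopic_submodular d X f"
  unfolding scopic_submodular_iff[OF assms(1)]
proof (intro allI impI)
  fix S T v
  assume "T \<subseteq> X \<and> S \<subseteq> T \<and> v \<in> X \<and> v \<notin> T"
  then have "T \<subseteq> X" "S \<subseteq> T" "v \<in> X" "v \<notin> T"
    by auto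
  define A where "A = {T'. T' \<subseteq> T \<and> marginal f {v} T \<le> marginal f {v} (S \<union> T')}"
  have "finite A"
    using finite_subset[OF \<open>T \<subseteq> X\<close> assms(1)] by (simp add: A_def)
  \<comment> \<open>Here \<open>S \<subseteq> T\<close> enters: \<open>S \<union> T\<close> is
    \<open>T\<close> itself.\<close>
  moreover have "T \<in> A"
    using \<open>S \<subseteq> T\<close> by (simp add: A_def Un_absorb1)
  ultimately obtain M where "M \<in> A" and minimal: "\<And>B. B \<in> A \<Longrightarrow> B \<subseteq> M \<Longrightarrow> M = B"
    using finite_has_minimal[of A] by blast
  have "card M \<le> d"
  proof (cases "M = {}")
    case False
    have "marginal f {v} (S \<union> T') < marginal f {v} (S \<union> M)" if "T' \<subset> M" for T'
    proof -
      \<comment> \<open>As \<open>T' \<subseteq> T\<close> still holds, only the inequality can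
        fail: the marginal at \<open>S \<union> T'\<close> is below that at \<open>T\<close>, which
        is at most that at \<open>S \<union> M\<close>.\<close>
      have "T' \<notin> A"
        using minimal that by blast
      then show ?thesis
        using that \<open>M \<in> A\<close> by (auto simp: A_def)
    qed
    \<comment> \<open>The witnesses are the given \<open>S\<close> and \<open>v\<close>;
      \<open>v\<close> avoids \<open>M\<close> because \<open>M \<subseteq> T\<close>.\<close>
    then have "supermodular_set X f M"
      unfolding supermodular_set_iff[OF assms(1) False]
      using \<open>M \<in> A\<close> \<open>T \<subseteq> X\<close> \<open>S \<subseteq> T\<close> \<open>v \<in> X\<close> \<open>v \<notin> T\<close> unfolding A_def by blast
    then show ?thesis
      using card_le False by blast
  qed simp
  then show "\<exists>T'\<subseteq>T. card T' \<le> d \<and> marginal f {v} T \<le> marginal f {v} (S \<union> T')"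
    using \<open>M \<in> A\<close> by (auto simp: A_def)
qed

theorem theorem1:
  fixes X :: "'a set" and d :: nat and f :: "'a set \<Rightarrow> real"
  assumes "finite X"
    and "normalized f"
    and "monotone_set_fun X f"
  shows "scopic_submodular d X f \<longleftrightarrow> SMW X f \<le> d"
  unfolding SMW_le_iff[OF assms(1)]
proof (intro iffI allI impI)
  fix T
  assume "scopic_submodular d X f" and "T \<noteq> {} \<and> supermodular_set X f T"
  then show "card T \<le> d"
    using card_supermodular_set_le[OF assms(1)] by auto
next
  assume "\<forall>T. T \<noteq> {} \<and> supermodular_set X f T \<longrightarrow> card T \<le> d"
  then show "scopic_submodular d X f"
    by (intro scopic_submodular_if_card_supermodular_set_le[OF assms(1)]) simp
qed

end
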